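(* Let $G$ be a group and let $X$ be a finite $G$-set. Suppose that $\mathcal{P}=\{\mathrm{orb}\,x\colon x\in X\}=\{C_1,C_2,\ldots,C_n\}$ is the set of (distinct) orbits of $G$ on $X$. Fix the ordered (orthonormal) basis of $L^G(X)$ $$\mathcal{B}=\left(\sqrt{\tfrac{|X|}{|C_1|}}\,\delta_{C_1},\sqrt{\tfrac{|X|}{|C_2|}}\,\delta_{C_2},\ldots,\sqrt{\tfrac{|X|}{|C_n|}}\,\delta_{C_n}\right).$$ Then the following assertions hold: (1) (Fourier expansion) The Fourier expansion with respect to $\mathcal{B}$ of a function $f\in L(X)$ is $$\widehat{f}=\left(\frac{1}{|C_1|}\sum_{x\in C_1}f(x)\right)\delta_{C_1}+\left(\frac{1}{|C_2|}\sum_{x\in C_2}f(x)\right)\delta_{C_2}+\cdots+\left(\frac{1}{|C_n|}\sum_{x\in C_n}f(x)\right)\delta_{C_n};$$ that is, the Fourier coefficients of $f$ are given by $$\left\langle f,\sqrt{\tfrac{|X|}{|C_i|}}\,\delta_{C_i}\right\rangle=\frac{1}{\sqrt{|X||C_i|}}\sum_{x\in C_i}f(x)$$ for all $i=1,2,\ldots,n$. (2) (Bessel's inequality) For all $f\in L(X)$, $$\sum_{i=1}^{n}\frac{1}{|C_i|}\left|\sum_{x\in C_i}f(x)\right|^2\leq\sum_{x\in X}|f(x)|^2.$$ (3) If $G$ acts nontrivially on $X$, then there exists a function $f\in L(X)$ with $\|\widehat{f}\|<\|f\|$; that is, equality in Bessel's inequality is not attained for this $f$.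
   Context: A $G$-set is a nonempty set $X$ with an action of the group $G$ (here $G$ may be finite or infinite), written $a\cdot x$; $\mathrm{orb}\,x=\{a\cdot x\colon a\in G\}$. $G$ acts trivially on $X$ if $a\cdot x=x$ for all $a\in G$, $x\in X$, and nontrivially otherwise. $L(X)$ is the complex vector space of all functions $X\to\mathbb{C}$ with pointwise operations, and $L^G(X)=\{f\in L(X)\colon f(a\cdot x)=f(x)\text{ for all }a\in G,x\in X\}$. For $C\subseteq X$, $\delta_C$ is the indicator function of $C$. $L(X)$ carries the Hermitian inner product $\langle f,g\rangle=\frac{1}{|X|}\sum_{x\in X}f(x)\overline{g(x)}$, with norm $\|f\|=\sqrt{\langle f,f\rangle}$. The Fourier expansion of $f\in L(X)$ with respect to a finite orthonormal family $(u_1,\ldots,u_n)$ is $\widehat{f}=\sum_{i=1}^n\langle f,u_i\rangle u_i$, and the $\langle f,u_i\rangle$ are the Fourier coefficients. *)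

theory Defs
  imports
    Complex_Main
    "HOL-Library.Function_Algebras"
    "HOL-Library.Indicator_Function"
    "HOL-Algebra.Group_Action"
begin

text \<open>
  A function \<open>X \<rightarrow> \<complex>\<close> on a set \<open>X\<close> is represented by the total function that extends it by
  zero outside \<open>X\<close>.  With this convention \<open>L(X)\<close> is a subspace of the complex vector space of
  all functions \<open>'x \<Rightarrow> complex\<close> (with the pointwise operations), and for \<open>C \<subseteq> X\<close> the function
  \<open>\<delta>\<^sub>C\<close> is the library's \<open>indicator C\<close>.
\<close>

definition cscale :: "complex \<Rightarrow> ('x \<Rightarrow> complex) \<Rightarrow> ('x \<Rightarrow> complex)" where
  "cscale c f = (\<lambda>x. c * f x)"

global_interpretation cfun: vector_space "cscale :: complex \<Rightarrow> ('x \<Rightarrow> complex) \<Rightarrow> ('x \<Rightarrow> complex)"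
  by unfold_locales (auto simp: cscale_def fun_eq_iff algebra_simps)

definition L :: "'x set \<Rightarrow> ('x \<Rightarrow> complex) set" where
  "L X = {f. \<forall>x. x \<notin> X \<longrightarrow> f x = 0}"

lemma subspace_L: "cfun.subspace (L X)"
  by (auto simp: cfun.subspace_def L_def cscale_def)

lemma bij_betw_L_functions_on:
  "bij_betw (\<lambda>f. restrict f X) (L X) (X \<rightarrow>\<^sub>E (UNIV :: complex set))"
  by (rule bij_betw_byWitness[where f' = "\<lambda>g x. if x \<in> X then g x else 0"])
     (auto simp: L_def fun_eq_iff PiE_def extensional_def)

text \<open>
  A \<open>G\<close>-set is a nonempty set with a group action in the sense of the locale
  \<^locale>\<open>group_action\<close>; the action is \<open>a \<cdot> x = \<phi> a x\<close>.
\<close>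

definition G_set :: "('a, 'm) monoid_scheme \<Rightarrow> 'x set \<Rightarrow> ('a \<Rightarrow> 'x \<Rightarrow> 'x) \<Rightarrow> bool" where
  "G_set G X \<phi> \<longleftrightarrow> group_action G X \<phi> \<and> X \<noteq> {}"

definition acts_trivially :: "('a, 'm) monoid_scheme \<Rightarrow> 'x set \<Rightarrow> ('a \<Rightarrow> 'x \<Rightarrow> 'x) \<Rightarrow> bool" where
  "acts_trivially G X \<phi> \<longleftrightarrow> (\<forall>a\<in>carrier G. \<forall>x\<in>X. \<phi> a x = x)"

definition L_inv :: "('a, 'm) monoid_scheme \<Rightarrow> 'x set \<Rightarrow> ('a \<Rightarrow> 'x \<Rightarrow> 'x) \<Rightarrow> ('x \<Rightarrow> complex) set" where
  "L_inv G X \<phi> = {f \<in> L X. \<forall>a\<in>carrier G. \<forall>x\<in>X. f (\<phi> a x) = f x}"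

definition ip :: "'x set \<Rightarrow> ('x \<Rightarrow> complex) \<Rightarrow> ('x \<Rightarrow> complex) \<Rightarrow> complex" where
  "ip X f g = 1 / of_nat (card X) * (\<Sum>x\<in>X. f x * cnj (g x))"

text \<open>The number \<open>ip X f f\<close> is real and nonnegative, so taking its real part loses nothing.\<close>

definition L_norm :: "'x set \<Rightarrow> ('x \<Rightarrow> complex) \<Rightarrow> real" where
  "L_norm X f = sqrt (Re (ip X f f))"

lemma ip_self: "ip X f f = of_real ((\<Sum>x\<in>X. (cmod (f x))\<^sup>2) / real (card X))"
  by (simp add: ip_def complex_norm_square del: of_real_power)

text \<open>Families \<open>(u\<^sub>1, \<dots>, u\<^sub>n)\<close> are indexed by \<open>{1..n}\<close>.\<close>

definition orthonormal_family :: "'x set \<Rightarrow> nat \<Rightarrow> (nat \<Rightarrow> 'x \<Rightarrow> complex) \<Rightarrow> bool" where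
  "orthonormal_family X n u \<longleftrightarrow>
     (\<forall>i\<in>{1..n}. u i \<in> L X) \<and>
     (\<forall>i\<in>{1..n}. \<forall>j\<in>{1..n}. ip X (u i) (u j) = (if i = j then 1 else 0))"

definition ordered_basis :: "('x \<Rightarrow> complex) set \<Rightarrow> nat \<Rightarrow> (nat \<Rightarrow> 'x \<Rightarrow> complex) \<Rightarrow> bool" where
  "ordered_basis V n u \<longleftrightarrow>
     inj_on u {1..n} \<and> cfun.independent (u ` {1..n}) \<and> cfun.span (u ` {1..n}) = V"

definition fourier_expansion ::
    "'x set \<Rightarrow> nat \<Rightarrow> (nat \<Rightarrow> 'x \<Rightarrow> complex) \<Rightarrow> ('x \<Rightarrow> complex) \<Rightarrow> ('x \<Rightarrow> complex)" where
  "fourier_expansion X n u f = (\<Sum>i=1..n. cscale (ip X f (u i)) (u i))"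

definition orbit_basis :: "'x set \<Rightarrow> (nat \<Rightarrow> 'x set) \<Rightarrow> nat \<Rightarrow> 'x \<Rightarrow> complex" where
  "orbit_basis X C i = cscale (of_real (sqrt (real (card X) / real (card (C i))))) (indicator (C i))"

end

theory Submission
  imports Defs "HOL-Analysis.Convex"
begin

text \<open>
  Only the partition of \<open>X\<close> into orbits matters: the Fourier expansion replaces \<open>f\<close> by its mean
  on each cell, and Bessel's inequality is the Cauchy--Schwarz inequality on each cell separately.
  It is strict for the indicator of a point whose orbit has at least two elements, and such a point
  exists as soon as the action is nontrivial.
\<close>

section \<open>Sums of functions and a Cauchy--Schwarz estimate\<close>

lemma sum_fun_apply: "(\<Sum>i\<in>A. f i) x = (\<Sum>i\<in>A. f i x)"
  by (induction A rule: infinite_finite_induct) auto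

text \<open>The triangle inequality reduces this to real summands, where it is Cauchy--Schwarz
  against the constant family 1.\<close>

lemma norm_sum_squared_le:
  fixes f :: "'i \<Rightarrow> 'a::real_normed_vector"
  shows "(norm (\<Sum>i\<in>A. f i))\<^sup>2 \<le> real (card A) * (\<Sum>i\<in>A. (norm (f i))\<^sup>2)"
proof -
  have "(norm (\<Sum>i\<in>A. f i))\<^sup>2 \<le> (\<Sum>i\<in>A. norm (f i))\<^sup>2"
    by (intro power_mono norm_sum norm_ge_zero)
  also have "\<dots> \<le> (\<Sum>i\<in>A. (norm (f i))\<^sup>2) * real (card A)"
    by (rule sum_squared_le_sum_of_squares)
  finally show ?thesis by (simp add: mult.commute)
qed

section \<open>Finite partitions and functions constant on their cells\<close>

locale indexed_finite_partition =
  fixes X :: "'x set" and n :: nat and C :: "nat \<Rightarrow> 'x set"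
  assumes finite_X: "finite X"
    and cover: "(\<Union>i\<in>{1..n}. C i) = X"
    and nonempty: "i \<in> {1..n} \<Longrightarrow> C i \<noteq> {}"
    and disjoint: "i \<in> {1..n} \<Longrightarrow> j \<in> {1..n} \<Longrightarrow> i \<noteq> j \<Longrightarrow> C i \<inter> C j = {}"
begin

lemma cell_subset: "i \<in> {1..n} \<Longrightarrow> C i \<subseteq> X"
  using cover by blast

lemma finite_cell: "i \<in> {1..n} \<Longrightarrow> finite (C i)"
  using cell_subset finite_X finite_subset by blast

lemma card_cell_pos: "i \<in> {1..n} \<Longrightarrow> 0 < card (C i)"
  using nonempty finite_cell by (simp add: card_gt_0_iff)

text \<open>The index witnesses that \<open>X\<close> is nonempty: the locale admits
  \<open>n = 0\<close> with \<open>X\<close> empty.\<close>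

lemma card_pos: "i \<in> {1..n} \<Longrightarrow> 0 < card X"
  using cell_subset[of i] nonempty[of i] finite_X by (auto simp: card_gt_0_iff)

lemma sum_over_cells: "(\<Sum>x\<in>X. g x) = (\<Sum>i=1..n. \<Sum>x\<in>C i. g x)"
  unfolding cover[symmetric]
  by (rule sum.UNION_disjoint) (auto simp: finite_cell disjoint)

text \<open>By disjointness only the summand \<open>j = i\<close> survives at \<open>x\<close>.
  Reading off coefficients in this way yields linear independence, spanning and the norm of the
  Fourier expansion.\<close>

lemma step_function_on_cell:
  assumes "i \<in> {1..n}" "x \<in> C i"
  shows "(\<Sum>j=1..n. cscale (a j) (indicator (C j))) x = a i"
proof -
  have "(\<Sum>j=1..n. cscale (a j) (indicator (C j))) x = (\<Sum>j=1..n. if j = i then a i else 0)"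
    unfolding sum_fun_apply
    using assms disjoint by (intro sum.cong) (auto simp: cscale_def indicator_def)
  then show ?thesis using assms by simp
qed

lemma step_function_outside:
  "x \<notin> X \<Longrightarrow> (\<Sum>j=1..n. cscale (a j) (indicator (C j))) x = 0"
  using cover unfolding sum_fun_apply
  by (intro sum.neutral ballI) (auto simp: cscale_def indicator_def)

text \<open>Pythagoras for the mutually orthogonal cell indicators, obtained pointwise: the modulus
  is constant on each cell.\<close>

lemma sum_norm_step_function:
  "(\<Sum>x\<in>X. (cmod ((\<Sum>j=1..n. cscale (a j) (indicator (C j))) x))\<^sup>2)
     = (\<Sum>i=1..n. real (card (C i)) * (cmod (a i))\<^sup>2)"
  unfolding sum_over_cells
proof (rule sum.cong)
  fix i assume i: "i \<in> {1..n}"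
  have "(\<Sum>x\<in>C i. (cmod ((\<Sum>j=1..n. cscale (a j) (indicator (C j))) x))\<^sup>2)
      = (\<Sum>x\<in>C i. (cmod (a i))\<^sup>2)"
    by (rule sum.cong) (simp_all only: step_function_on_cell[OF i])
  then show "(\<Sum>x\<in>C i. (cmod ((\<Sum>j=1..n. cscale (a j) (indicator (C j))) x))\<^sup>2)
      = real (card (C i)) * (cmod (a i))\<^sup>2"
    by simp
qed simp

section \<open>Fourier coefficients and the orthonormal basis\<close>

lemma ip_orbit_basis:
  assumes i: "i \<in> {1..n}"
  shows "ip X f (orbit_basis X C i)
           = 1 / of_real (sqrt (real (card X) * real (card (C i)))) * (\<Sum>x\<in>C i. f x)"
proof -
  let ?w = "sqrt (real (card X) / real (card (C i)))"
  \<comment> \<open>The basis function vanishes off \<open>C i\<close>, and its weight there is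
    real, so conjugation has no effect.\<close>
  have "(\<Sum>x\<in>X. f x * cnj (orbit_basis X C i x)) = (\<Sum>x\<in>C i. f x * of_real ?w)"
    using cell_subset[OF i] finite_X
    by (intro sum.mono_neutral_cong_right) (auto simp: orbit_basis_def cscale_def)
  then have "ip X f (orbit_basis X C i)
               = of_real (?w / real (card X)) * (\<Sum>x\<in>C i. f x)"
    by (simp add: ip_def sum_distrib_right[symmetric])
  also have "?w / real (card X) = 1 / sqrt (real (card X) * real (card (C i)))"
    using card_pos[OF i] card_cell_pos[OF i]
    by (simp add: real_sqrt_divide real_sqrt_mult field_simps)
  finally show ?thesis by simp
qed

lemma fourier_expansion_orbit_basis:
  "fourier_expansion X n (orbit_basis X C) f
     = (\<Sum>i=1..n. cscale (1 / of_nat (card (C i)) * (\<Sum>x\<in>C i. f x)) (indicator (C i)))"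
  unfolding fourier_expansion_def
proof (rule sum.cong)
  fix i assume i: "i \<in> {1..n}"
  let ?w = "sqrt (real (card X) / real (card (C i)))"
  \<comment> \<open>The weight enters once through the coefficient and once through the basis
    vector; the two square roots combine into the averaging factor.\<close>
  have "?w / sqrt (real (card X) * real (card (C i))) = 1 / real (card (C i))"
    using card_pos[OF i] card_cell_pos[OF i]
    by (simp add: real_sqrt_divide real_sqrt_mult field_simps)
  then have "complex_of_real ?w / of_real (sqrt (real (card X) * real (card (C i))))
               = 1 / of_nat (card (C i))"
    by (metis of_real_1 of_real_divide of_real_of_nat_eq)
  then have "ip X f (orbit_basis X C i) * of_real ?w
               = 1 / of_nat (card (C i)) * (\<Sum>x\<in>C i. f x)"
    unfolding ip_orbit_basis[OF i] by (metis mult.commute mult.left_commute mult_1 times_divide_eq_left)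
  then show "cscale (ip X f (orbit_basis X C i)) (orbit_basis X C i)
      = cscale (1 / of_nat (card (C i)) * (\<Sum>x\<in>C i. f x)) (indicator (C i))"
    unfolding orbit_basis_def[of X C i] cfun.scale_scale by simp
qed simp

text \<open>The coefficient formula is applied with a basis vector in place of \<open>f\<close>. Its
  sum over \<open>C j\<close> is the cell size times the weight if \<open>i = j\<close>, and
  vanishes by disjointness otherwise.\<close>

lemma orthonormal_orbit_basis: "orthonormal_family X n (orbit_basis X C)"
  unfolding orthonormal_family_def
proof (intro conjI ballI)
  fix i assume i: "i \<in> {1..n}"
  show "orbit_basis X C i \<in> L X"
    using cell_subset[OF i] by (auto simp: L_def orbit_basis_def cscale_def indicator_def)
  fix j assume j: "j \<in> {1..n}"
  show "ip X (orbit_basis X C i) (orbit_basis X C j) = (if i = j then 1 else 0)"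
  proof (cases "i = j")
    case True
    let ?w = "sqrt (real (card X) / real (card (C i)))"
    have "1 / sqrt (real (card X) * real (card (C i))) * (real (card (C i)) * ?w) = 1"
      using card_pos[OF i] card_cell_pos[OF i]
      by (simp add: real_sqrt_divide real_sqrt_mult field_simps)
    from arg_cong[OF this, of complex_of_real]
    have "1 / complex_of_real (sqrt (real (card X) * real (card (C i))))
            * (of_nat (card (C i)) * of_real ?w) = 1"
      by (simp only: of_real_1 of_real_divide of_real_mult of_real_of_nat_eq)
    moreover have "(\<Sum>x\<in>C i. orbit_basis X C i x) = of_nat (card (C i)) * of_real ?w"
      by (simp add: orbit_basis_def cscale_def)
    ultimately show ?thesis unfolding ip_orbit_basis[OF j] using True by simp
  next
    case False
    then have "(\<Sum>x\<in>C j. orbit_basis X C i x) = 0"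
      using disjoint[OF i j] by (intro sum.neutral) (auto simp: orbit_basis_def cscale_def indicator_def)
    then show ?thesis unfolding ip_orbit_basis[OF j] using False by simp
  qed
qed

text \<open>The space is described through the cells alone; for the partition into orbits it is
  later identified with the invariant functions.\<close>

lemma ordered_basis_orbit_basis:
  "ordered_basis {f \<in> L X. \<forall>i\<in>{1..n}. \<forall>x\<in>C i. \<forall>y\<in>C i. f x = f y} n (orbit_basis X C)"
    (is "ordered_basis ?V n ?u")
proof -
  define w :: "nat \<Rightarrow> complex" where "w i = of_real (sqrt (real (card X) / real (card (C i))))" for i
  have u: "?u i = cscale (w i) (indicator (C i))" for i
    by (simp add: orbit_basis_def w_def)
  have w: "w i \<noteq> 0" if "i \<in> {1..n}" for i
    using card_pos[OF that] card_cell_pos[OF that] by (simp add: w_def)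
  have inj: "inj_on ?u {1..n}"
  proof (rule inj_onI, rule ccontr)
    fix i j assume ij: "i \<in> {1..n}" "j \<in> {1..n}" and eq: "?u i = ?u j" and ne: "i \<noteq> j"
    obtain x where x: "x \<in> C i" using nonempty ij by blast
    then have "x \<notin> C j" using disjoint ij ne by blast
    then have "?u i x = w i" "?u j x = 0" using x by (auto simp: u cscale_def)
    then show False using eq w ij by simp
  qed
  have "cfun.independent (?u ` {1..n})"
  proof (rule cfun.independent_if_scalars_zero)
    fix c v assume sum0: "(\<Sum>v\<in>?u ` {1..n}. cscale (c v) v) = 0" and "v \<in> ?u ` {1..n}"
    then obtain i where i: "i \<in> {1..n}" and v: "v = ?u i" by blast
    obtain x where x: "x \<in> C i" using nonempty i by blast
    \<comment> \<open>Injectivity turns the sum over the image set into a sum over indices;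
      evaluating it at \<open>x\<close> isolates the coefficient of index \<open>i\<close>.\<close>
    have "(\<Sum>j=1..n. cscale (c (?u j) * w j) (indicator (C j))) = 0"
      using sum0 unfolding sum.reindex[OF inj] o_def by (simp add: u)
    then have "c (?u i) * w i = 0"
      using step_function_on_cell[OF i x, of "\<lambda>j. c (?u j) * w j"] by simp
    then show "c v = 0" using w i v by simp
  qed simp
  moreover have "cfun.span (?u ` {1..n}) = ?V"
  proof
    have "cfun.subspace ?V"
    proof (rule cfun.subspaceI)
      fix f g assume fg: "f \<in> ?V" "g \<in> ?V"
      then have "f x + g x = f y + g y" if "i \<in> {1..n}" "x \<in> C i" "y \<in> C i" for i x y
        using that by (intro arg_cong2[where f = "(+)"]) blast+
      moreover have "f + g \<in> L X" using fg cfun.subspace_add[OF subspace_L] by blast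
      ultimately show "f + g \<in> ?V" unfolding mem_Collect_eq plus_fun_apply by blast
    next
      fix c f assume f: "f \<in> ?V"
      then have "c * f x = c * f y" if "i \<in> {1..n}" "x \<in> C i" "y \<in> C i" for i x y
        using that by (intro arg_cong[where f = "(*) c"]) blast
      moreover have "cscale c f \<in> L X" using f cfun.subspace_scale[OF subspace_L] by blast
      ultimately show "cscale c f \<in> ?V" unfolding mem_Collect_eq by (simp only: cscale_def) blast
    qed (simp add: L_def)
    moreover have "?u ` {1..n} \<subseteq> ?V"
    proof clarify
      fix i assume i: "i \<in> {1..n}"
      have "?u i x = ?u i y" if "j \<in> {1..n}" "x \<in> C j" "y \<in> C j" for j x y
        using that disjoint[OF i that(1)] by (cases "i = j") (auto simp: u cscale_def indicator_def)
      moreover have "?u i \<in> L X"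
        using orthonormal_orbit_basis i unfolding orthonormal_family_def by blast
      ultimately show "?u i \<in> L X \<and> (\<forall>j\<in>{1..n}. \<forall>x\<in>C j. \<forall>y\<in>C j. ?u i x = ?u i y)"
        by blast
    qed
    ultimately show "cfun.span (?u ` {1..n}) \<subseteq> ?V"
      by (rule cfun.span_minimal[rotated])
  next
    show "?V \<subseteq> cfun.span (?u ` {1..n})"
    proof
      fix f assume f: "f \<in> ?V"
      \<comment> \<open>Any representative of the cell serves, since \<open>f\<close> is constant
        there.\<close>
      define a where "a i = f (SOME x. x \<in> C i)" for i
      have fa: "f x = a i" if i: "i \<in> {1..n}" and x: "x \<in> C i" for i x
        using f i x someI[of "\<lambda>x. x \<in> C i", OF x] unfolding a_def by blast
      have "f x = (\<Sum>i=1..n. cscale (a i) (indicator (C i))) x" for x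
      proof (cases "x \<in> X")
        case True
        then obtain i where i: "i \<in> {1..n}" "x \<in> C i" using cover by blast
        then show ?thesis using fa step_function_on_cell by simp
      next
        case False
        then show ?thesis using f step_function_outside[of x a] by (simp add: L_def)
      qed
      then have "f = (\<Sum>i=1..n. cscale (a i) (indicator (C i)))" by blast
      \<comment> \<open>Dividing by the nonzero weight compensates for the normalization of the
        basis vector.\<close>
      also have "\<dots> = (\<Sum>i=1..n. cscale (a i / w i) (?u i))"
        using w by (intro sum.cong) (auto simp: u)
      finally have f_eq: "f = (\<Sum>i=1..n. cscale (a i / w i) (?u i))" .
      show "f \<in> cfun.span (?u ` {1..n})"
        unfolding f_eq by (intro cfun.span_sum cfun.span_scale cfun.span_base imageI)
    qed
  qed
  ultimately show ?thesis unfolding ordered_basis_def using inj by blast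
qed

section \<open>Bessel's inequality and a strict instance\<close>

lemma bessel_cells:
  "(\<Sum>i=1..n. 1 / real (card (C i)) * (cmod (\<Sum>x\<in>C i. f x))\<^sup>2) \<le> (\<Sum>x\<in>X. (cmod (f x))\<^sup>2)"
  unfolding sum_over_cells
proof (rule sum_mono)
  fix i assume i: "i \<in> {1..n}"
  show "1 / real (card (C i)) * (cmod (\<Sum>x\<in>C i. f x))\<^sup>2 \<le> (\<Sum>x\<in>C i. (cmod (f x))\<^sup>2)"
    using norm_sum_squared_le[of f "C i"] card_cell_pos[OF i] by (simp add: field_simps)
qed

text \<open>Identifies the left side of Bessel's inequality, divided by the size of
  \<open>X\<close>, with the squared norm of the expansion, so that strictness carries over to
  norms.\<close>

lemma L_norm_fourier_expansion:
  "L_norm X (fourier_expansion X n (orbit_basis X C) f)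
     = sqrt ((\<Sum>i=1..n. 1 / real (card (C i)) * (cmod (\<Sum>x\<in>C i. f x))\<^sup>2) / real (card X))"
proof -
  have "(\<Sum>i=1..n. real (card (C i)) * (cmod (1 / of_nat (card (C i)) * (\<Sum>x\<in>C i. f x)))\<^sup>2)
      = (\<Sum>i=1..n. 1 / real (card (C i)) * (cmod (\<Sum>x\<in>C i. f x))\<^sup>2)"
    using card_cell_pos
    by (intro sum.cong) (simp_all add: norm_mult norm_divide power2_eq_square)
  then show ?thesis
    unfolding L_norm_def ip_self Re_complex_of_real fourier_expansion_orbit_basis
      sum_norm_step_function by simp
qed

text \<open>Only the cell of \<open>x\<close> contributes on the left, giving
  \<open>1 / card (C i)\<close>, while the right side is 1; the second point \<open>y\<close> forces
  \<open>card (C i)\<close> to be at least 2.\<close>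

lemma bessel_strict_indicator:
  assumes i: "i \<in> {1..n}" and x: "x \<in> C i" and y: "y \<in> C i" and "x \<noteq> y"
  shows "(\<Sum>j=1..n. 1 / real (card (C j)) * (cmod (\<Sum>z\<in>C j. indicator {x} z))\<^sup>2)
           < (\<Sum>z\<in>X. (cmod (indicator {x} z))\<^sup>2)"
proof -
  have cell: "(\<Sum>z\<in>C j. indicator {x} z) = (if j = i then 1 else 0 :: complex)" if j: "j \<in> {1..n}" for j
    using x disjoint[OF i j] finite_cell[OF j]
    by (auto simp: indicator_def)
  have "(\<Sum>j=1..n. 1 / real (card (C j)) * (cmod (\<Sum>z\<in>C j. indicator {x} z))\<^sup>2)
      = (\<Sum>j=1..n. if j = i then 1 / real (card (C i)) else 0)"
    by (intro sum.cong) (auto simp: cell)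
  also have "\<dots> = 1 / real (card (C i))" using i by simp
  also have "\<dots> < 1"
  proof -
    have "card {x, y} \<le> card (C i)" using finite_cell[OF i] x y by (intro card_mono) auto
    then show ?thesis using \<open>x \<noteq> y\<close> by simp
  qed
  also have "1 = (\<Sum>z\<in>X. if z = x then 1 else 0 :: real)"
    using cell_subset[OF i] x finite_X by auto
  also have "\<dots> = (\<Sum>z\<in>X. (cmod (indicator {x} z))\<^sup>2)"
    by (intro sum.cong) (auto simp: indicator_def)
  finally show ?thesis .
qed

end

section \<open>Orbits as cells and invariance as constancy on orbits\<close>

lemma (in group_action) indexed_finite_partition_orbits:
  assumes "finite E" "bij_betw C {1..n} (orbits G E \<phi>)"
  shows "indexed_finite_partition E n C"
proof
  show "(\<Union>i\<in>{1..n}. C i) = E"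
    using orbits_coverture assms(2) by (simp add: bij_betw_def)
  have orb: "C i \<in> orbits G E \<phi>" if "i \<in> {1..n}" for i
    using assms(2) that by (auto simp: bij_betw_def)
  show "C i \<noteq> {}" if "i \<in> {1..n}" for i
    using orb[OF that] orbit_refl by (auto simp: orbits_def)
  show "C i \<inter> C j = {}" if "i \<in> {1..n}" "j \<in> {1..n}" "i \<noteq> j" for i j
  proof -
    \<comment> \<open>Injectivity of \<open>C\<close> gives distinct orbits, and two orbits are
      either equal or disjoint.\<close>
    have "C i \<noteq> C j" using assms(2) that by (auto simp: bij_betw_def dest: inj_onD)
    then show ?thesis using disjoint_union[OF orb[OF that(1)] orb[OF that(2)]] by blast
  qed
qed (fact assms)

text \<open>Since \<open>x\<close> lies in its own orbit, constancy allows comparison with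
  \<open>f x\<close>; conversely every orbit element is some \<open>\<phi> a x\<close>, so all
  values equal \<open>f x\<close>.\<close>

lemma (in group_action) constant_on_orbit_iff:
  assumes x: "x \<in> E"
  shows "(\<forall>y\<in>orbit G \<phi> x. \<forall>z\<in>orbit G \<phi> x. f y = f z) \<longleftrightarrow> (\<forall>a\<in>carrier G. f (\<phi> a x) = f x)"
proof
  assume "\<forall>y\<in>orbit G \<phi> x. \<forall>z\<in>orbit G \<phi> x. f y = f z"
  then show "\<forall>a\<in>carrier G. f (\<phi> a x) = f x"
    using orbit_refl[OF x] unfolding orbit_def by blast
qed (auto simp: orbit_def)

lemma (in group_action) L_inv_eq_constant_on_orbits:
  assumes "bij_betw C I (orbits G E \<phi>)"
  shows "L_inv G E \<phi> = {f \<in> L E. \<forall>i\<in>I. \<forall>y\<in>C i. \<forall>z\<in>C i. f y = f z}"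
proof -
  have "orbits G E \<phi> = orbit G \<phi> ` E"
    unfolding orbits_def by (rule Setcompr_eq_image)
  then have "C ` I = orbit G \<phi> ` E"
    using bij_betw_imp_surj_on[OF assms] by (rule trans[rotated])
  \<comment> \<open>The indexed cells and the orbits of points form the same family of sets, so
    quantifying over either is equivalent.\<close>
  then have cells_are_orbits: "(\<forall>i\<in>I. P (C i)) \<longleftrightarrow> (\<forall>x\<in>E. P (orbit G \<phi> x))" for P
    using ball_simps(9)[of C I P] ball_simps(9)[of "orbit G \<phi>" E P] by (simp only:)
  have "(\<forall>i\<in>I. \<forall>y\<in>C i. \<forall>z\<in>C i. f y = f z) \<longleftrightarrow> (\<forall>a\<in>carrier G. \<forall>x\<in>E. f (\<phi> a x) = f x)"
    for f :: "_ \<Rightarrow> complex"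
  proof -
    have "(\<forall>i\<in>I. \<forall>y\<in>C i. \<forall>z\<in>C i. f y = f z)
        \<longleftrightarrow> (\<forall>x\<in>E. \<forall>y\<in>orbit G \<phi> x. \<forall>z\<in>orbit G \<phi> x. f y = f z)"
      by (rule cells_are_orbits)
    also have "\<dots> \<longleftrightarrow> (\<forall>x\<in>E. \<forall>a\<in>carrier G. f (\<phi> a x) = f x)"
      by (rule ball_cong[OF refl constant_on_orbit_iff])
    finally show ?thesis by blast
  qed
  then show ?thesis unfolding L_inv_def by (simp only:)
qed

theorem theorem3p10:
  fixes G :: "('a, 'm) monoid_scheme"
    and X :: "'x set"
    and \<phi> :: "'a \<Rightarrow> 'x \<Rightarrow> 'x"
    and n :: nat
    and C :: "nat \<Rightarrow> 'x set"
  assumes "group G"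
    and "G_set G X \<phi>"
    and "finite X"
    and "bij_betw C {1..n} (orbits G X \<phi>)"
  shows
    "ordered_basis (L_inv G X \<phi>) n (orbit_basis X C) \<and> orthonormal_family X n (orbit_basis X C) \<and>
     (\<forall>f\<in>L X.
       fourier_expansion X n (orbit_basis X C) f =
         (\<Sum>i=1..n. cscale (1 / of_nat (card (C i)) * (\<Sum>x\<in>C i. f x)) (indicator (C i))) \<and>
       (\<forall>i\<in>{1..n}. ip X f (orbit_basis X C i) =
         1 / of_real (sqrt (real (card X) * real (card (C i)))) * (\<Sum>x\<in>C i. f x))) \<and>
     (\<forall>f\<in>L X.
       (\<Sum>i=1..n. 1 / real (card (C i)) * (cmod (\<Sum>x\<in>C i. f x))\<^sup>2) \<le> (\<Sum>x\<in>X. (cmod (f x))\<^sup>2)) \<and>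
     (\<not> acts_trivially G X \<phi> \<longrightarrow>
       (\<exists>f\<in>L X.
          L_norm X (fourier_expansion X n (orbit_basis X C) f) < L_norm X f \<and>
          (\<Sum>i=1..n. 1 / real (card (C i)) * (cmod (\<Sum>x\<in>C i. f x))\<^sup>2)
            \<noteq> (\<Sum>x\<in>X. (cmod (f x))\<^sup>2)))"
proof -
  interpret group_action G X \<phi> using assms(2) by (simp add: G_set_def)
  interpret indexed_finite_partition X n C
    by (rule indexed_finite_partition_orbits[OF assms(3,4)])
  have "\<exists>f\<in>L X.
          L_norm X (fourier_expansion X n (orbit_basis X C) f) < L_norm X f \<and>
          (\<Sum>i=1..n. 1 / real (card (C i)) * (cmod (\<Sum>x\<in>C i. f x))\<^sup>2)
            \<noteq> (\<Sum>x\<in>X. (cmod (f x))\<^sup>2)" if nontrivial: "\<not> acts_trivially G X \<phi>"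
  proof -
    obtain a x where a: "a \<in> carrier G" and x: "x \<in> X" and moved: "\<phi> a x \<noteq> x"
      using nontrivial by (auto simp: acts_trivially_def)
    have "orbit G \<phi> x \<in> orbits G X \<phi>" using x by (auto simp: orbits_def)
    then obtain i where i: "i \<in> {1..n}" and Ci: "C i = orbit G \<phi> x"
      using assms(4) by (metis bij_betw_imp_surj_on imageE)
    \<comment> \<open>A moved point and its image are two distinct elements of one orbit, as the
      strict instance requires.\<close>
    have "x \<in> C i" "\<phi> a x \<in> C i"
      using orbit_refl[OF x] a by (auto simp: Ci orbit_def)
    note strict = bessel_strict_indicator[OF i this moved[symmetric]]
    have "indicator {x} \<in> L X" using x by (auto simp: L_def indicator_def)
    moreover have "L_norm X (fourier_expansion X n (orbit_basis X C) (indicator {x}))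
        < L_norm X (indicator {x})"
      \<comment> \<open>The norm of the expansion is rewritten before \<open>L_norm_def\<close> is
        unfolded, which would destroy its pattern. Strictness then survives division by the positive
        \<open>card X\<close> and the square root.\<close>
      unfolding L_norm_fourier_expansion
      unfolding L_norm_def ip_self Re_complex_of_real
      using strict card_pos[OF i] by (intro real_sqrt_less_mono divide_strict_right_mono) auto
    ultimately show ?thesis using strict by (intro bexI[of _ "indicator {x}"]) auto
  qed
  then show ?thesis
    using ordered_basis_orbit_basis orthonormal_orbit_basis fourier_expansion_orbit_basis
      ip_orbit_basis bessel_cells
    unfolding L_inv_eq_constant_on_orbits[OF assms(4)] by blast
qed

end
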